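(* Let $m\ge n>k\ge 1$ be integers and let $R=\begin{pmatrix}A&B\\ C&D\end{pmatrix}$ be a real $m\times n$ matrix with $A$ of size $k\times k$, $B$ of size $k\times(n-k)$, $C$ of size $(m-k)\times k$ and $D$ of size $(m-k)\times(n-k)$. Let $R_0=\begin{pmatrix}A&B\\ C&0\end{pmatrix}$. Fix singular value decompositions $Q(R)\,R\,Q'(R)=\Sigma(R)$ and $Q(R_0)\,R_0\,Q'(R_0)=\Sigma(R_0)$. With the notation $\mu_{j,k}$, $c_2(\cdot,i)$, $c_2'(\cdot,i)$ of the context: (1) For every $i=1,\dots,n$, $$|\sigma_i(R)-\sigma_i(R_0)|\le \max\{\mu_{i-1,k}(R),\ \mu_{i-1,k}(R_0)\}.$$ (2) In particular, if $k<i\le n$, then $$|\sigma_i(R)-\sigma_i(R_0)|\le\max\Big\{\min\{\|c_2(R,i)D\|,\|Dc_2'(R,i)\|\},\ \min\{\|c_2(R_0,i)D\|,\|Dc_2'(R_0,i)\|\}\Big\}.$$ (3) If $2k<i\le n$, then $$\sigma_i(R)\le\max\Big\{\min\{\|c_2(R,i)D\|,\|Dc_2'(R,i)\|\},\ \min\{\|c_2(R_0,i)D\|,\|Dc_2'(R_0,i)\|\}\Big\}.$$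
   Context: $\|\cdot\|$ is the operator (spectral) norm, and $\sigma_1(X)\ge\sigma_2(X)\ge\cdots$ are the singular values of $X$ in decreasing order (equal to $0$ beyond the rank). For $X\in\{R,R_0\}$, $Q(X)$ is an orthogonal $m\times m$ matrix and $Q'(X)$ an orthogonal $n\times n$ matrix such that $Q(X)XQ'(X)=\Sigma(X)$ is the $m\times n$ (rectangular) diagonal matrix of the singular values of $X$ in decreasing order. $M[a:b,\,c:d]$ denotes the submatrix of $M$ with rows $a,\dots,b$ and columns $c,\dots,d$. For $X\in\{R,R_0\}$ and $0\le j\le n-1$, with $D$ always the bottom right block of $R$, $$\mu_{j,k}(X)=\min\big\{\|D\,(Q'(X)[k+1:n,\ j+1:n])\|,\ \|(Q(X)[j+1:m,\ k+1:m])\,D\|\big\}.$$ $c_2(X)=Q(X)[k+1:m,\,k+1:m]$ and $c_2'(X)=Q'(X)[k+1:n,\,k+1:n]$ are the bottom right blocks of $Q(X)$ and $Q'(X)$. For $i>k$, $c_2(X,i)=c_2(X)[i-k:m-k,\ 1:m-k]$ and $c_2'(X,i)=c_2'(X)[1:n-k,\ i-k:n-k]$. *)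

theory Defs
  imports
    Jordan_Normal_Form.Char_Poly
    Jordan_Normal_Form.DL_Submatrix
    "HOL-Analysis.L2_Norm"
begin

definition l2norm :: "real vec \<Rightarrow> real" where
  "l2norm v = L2_set (\<lambda>i. v $ i) {..<dim_vec v}"

definition op_norm :: "real mat \<Rightarrow> real" where
  "op_norm M = (SUP v \<in> {v \<in> carrier_vec (dim_col M). l2norm v \<le> 1}. l2norm (M *\<^sub>v v))"

text \<open>The singular values of \<open>X\<close> are the square roots of the eigenvalues of \<open>X\<^sup>T X\<close>, counted with
  their algebraic multiplicity and listed in decreasing order. All roots of this characteristic
  polynomial are real and nonnegative, so the list has one entry per column of \<open>X\<close>. The index
  \<open>i\<close> of \<open>sigma X i\<close> starts at 1.\<close>

definition singular_values :: "real mat \<Rightarrow> real list" where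
  "singular_values X =
     rev (sorted_list_of_multiset (image_mset sqrt (proots (char_poly (X\<^sup>T * X)))))"

definition sigma :: "real mat \<Rightarrow> nat \<Rightarrow> real" where
  "sigma X i =
     (if 1 \<le> i \<and> i \<le> length (singular_values X) then singular_values X ! (i - 1) else 0)"

definition Sigma_mat :: "real mat \<Rightarrow> real mat" where
  "Sigma_mat X = mat (dim_row X) (dim_col X) (\<lambda>(i, j). if i = j then sigma X (i + 1) else 0)"

text \<open>The constant \<open>orthogonal_mat\<close> of the matrix library only asks for pairwise orthogonal nonzero
  columns, without normalization, hence the following definition.\<close>

definition orthogonal_matrix :: "nat \<Rightarrow> real mat \<Rightarrow> bool" where
  "orthogonal_matrix d Q \<longleftrightarrow> Q \<in> carrier_mat d d \<and> Q\<^sup>T * Q = 1\<^sub>m d \<and> Q * Q\<^sup>T = 1\<^sub>m d"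

definition is_svd :: "real mat \<Rightarrow> real mat \<Rightarrow> real mat \<Rightarrow> bool" where
  "is_svd X Q Q' \<longleftrightarrow>
     orthogonal_matrix (dim_row X) Q \<and> orthogonal_matrix (dim_col X) Q' \<and>
     Q * X * Q' = Sigma_mat X"

text \<open>\<open>block M a b c d\<close> is \<open>M[a:b, c:d]\<close>, with rows and columns numbered from 1 and both ends
  included; the matrix library numbers them from 0.\<close>

definition block :: "real mat \<Rightarrow> nat \<Rightarrow> nat \<Rightarrow> nat \<Rightarrow> nat \<Rightarrow> real mat" where
  "block M a b c d = submatrix M {a - 1..<b} {c - 1..<d}"

lemma pick_atLeastLessThan: "a + i < b \<Longrightarrow> pick {a..<b} i = a + i"
proof (induction i)
  case 0
  then show ?case by (auto intro: Least_equality)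
next
  case (Suc i)
  then show ?case by (auto intro!: Least_equality)
qed

lemma block_eq:
  assumes "1 \<le> a" "b \<le> dim_row M" "1 \<le> c" "d \<le> dim_col M"
  shows "block M a b c d = mat (b + 1 - a) (d + 1 - c) (\<lambda>(i, j). M $$ (a - 1 + i, c - 1 + j))"
proof -
  have "{i. i < dim_row M \<and> i \<in> {a - 1..<b}} = {a - 1..<b}"
    and "{i. i < dim_col M \<and> i \<in> {c - 1..<d}} = {c - 1..<d}"
    using assms by auto
  then show ?thesis
    unfolding block_def submatrix_def using assms
    by (intro eq_matI) (auto simp: pick_atLeastLessThan)
qed

text \<open>In the following, \<open>m\<close> and \<open>n\<close> are the sizes of the square matrices \<open>Q = Q(X)\<close> and
  \<open>Q' = Q'(X)\<close>, and \<open>D\<close> is always the bottom right block of \<open>R\<close>, also when \<open>X = R\<^sub>0\<close>.\<close>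

definition mu :: "real mat \<Rightarrow> real mat \<Rightarrow> real mat \<Rightarrow> nat \<Rightarrow> nat \<Rightarrow> real" where
  "mu D Q Q' j k =
     (let m = dim_row Q; n = dim_row Q' in
      min (op_norm (D * block Q' (k + 1) n (j + 1) n))
          (op_norm (block Q (j + 1) m (k + 1) m * D)))"

definition c2 :: "real mat \<Rightarrow> nat \<Rightarrow> real mat" where
  "c2 Q k = (let m = dim_row Q in block Q (k + 1) m (k + 1) m)"

definition c2_rows :: "real mat \<Rightarrow> nat \<Rightarrow> nat \<Rightarrow> real mat" where
  "c2_rows Q k i = (let m = dim_row Q in block (c2 Q k) (i - k) (m - k) 1 (m - k))"

definition c2_cols :: "real mat \<Rightarrow> nat \<Rightarrow> nat \<Rightarrow> real mat" where
  "c2_cols Q' k i = (let n = dim_row Q' in block (c2 Q' k) 1 (n - k) (i - k) (n - k))"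

end

theory Submission
  imports Defs
begin

text \<open>Let \<open>V\<close> be spanned by the right singular vectors of \<open>R\<close> number \<open>i, \<dots>, n\<close>, and \<open>W\<close> by the right
  singular vectors of \<open>R\<^sub>0\<close> number \<open>1, \<dots>, i\<close>. Their dimensions add up to \<open>n + 1\<close>, so they share a
  nonzero vector \<open>v\<close>, and \<open>\<sigma>\<^sub>i(R\<^sub>0) |v| \<le> |R\<^sub>0 v| \<le> |R v| + |D v\<^sub>2| \<le> \<sigma>\<^sub>i(R) |v| + |D v\<^sub>2|\<close>, where \<open>v\<^sub>2\<close>
  consists of the last \<open>n - k\<close> entries of \<open>v\<close> and is obtained by applying a block of \<open>Q'(R)\<close> to the
  coordinates of \<open>v\<close> in \<open>V\<close>. Transposing gives the bound with the block of \<open>Q(R)\<close>, and exchanging \<open>R\<close>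
  and \<open>R\<^sub>0\<close> gives the reverse inequality. The second claim is the first one with the
  blocks renamed, and the third holds because \<open>R\<^sub>0\<close> has rank at most \<open>2 k\<close>.\<close>

section \<open>Euclidean norm of vectors\<close>

lemma l2norm_nonneg [simp]: "0 \<le> l2norm v"
  by (simp add: l2norm_def)

lemma l2norm_power2: "(l2norm v)\<^sup>2 = (\<Sum>i<dim_vec v. (v $ i)\<^sup>2)"
  by (simp add: l2norm_def L2_set_def sum_nonneg)

lemma scalar_prod_self: "v \<bullet> v = (l2norm v)\<^sup>2"
  unfolding l2norm_power2 by (simp add: scalar_prod_def power2_eq_square atLeast0LessThan)

lemma l2norm_eqI: "v \<bullet> v = w \<bullet> w \<Longrightarrow> l2norm v = l2norm w"
  by (simp add: scalar_prod_self)

lemma l2norm_zero [simp]: "l2norm (0\<^sub>v n) = 0"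
  by (simp add: l2norm_def L2_set_def)

lemma l2norm_eq_0_iff: "v \<in> carrier_vec n \<Longrightarrow> l2norm v = 0 \<longleftrightarrow> v = 0\<^sub>v n"
  by (auto simp: l2norm_def L2_set_eq_0_iff intro!: eq_vecI)

lemma scalar_prod_le_l2norm:
  assumes "v \<in> carrier_vec n" "w \<in> carrier_vec n"
  shows "\<bar>v \<bullet> w\<bar> \<le> l2norm v * l2norm w"
proof -
  have "\<bar>v \<bullet> w\<bar> \<le> (\<Sum>i<n. \<bar>v $ i\<bar> * \<bar>w $ i\<bar>)"
    using assms sum_abs[of "\<lambda>i. v $ i * w $ i" "{..<n}"]
    by (simp add: scalar_prod_def atLeast0LessThan abs_mult)
  also have "\<dots> \<le> l2norm v * l2norm w"
    using assms L2_set_mult_ineq[of "\<lambda>i. v $ i" "\<lambda>i. w $ i" "{..<n}"] by (simp add: l2norm_def)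
  finally show ?thesis .
qed

lemma l2norm_smult: "l2norm (c \<cdot>\<^sub>v v) = \<bar>c\<bar> * l2norm v"
proof (rule power2_eq_imp_eq)
  show "(l2norm (c \<cdot>\<^sub>v v))\<^sup>2 = (\<bar>c\<bar> * l2norm v)\<^sup>2"
    by (simp add: l2norm_power2 power_mult_distrib sum_distrib_left)
qed auto

lemma l2norm_uminus [simp]: "l2norm (- v) = l2norm v"
  by (simp add: l2norm_def L2_set_def)

lemma l2norm_add_le:
  assumes "v \<in> carrier_vec n" "w \<in> carrier_vec n"
  shows "l2norm (v + w) \<le> l2norm v + l2norm w"
  using assms L2_set_triangle_ineq[of "\<lambda>i. v $ i" "\<lambda>i. w $ i" "{..<n}"]
  by (simp add: l2norm_def cong: L2_set_cong_simp)

lemma l2norm_append_zero: "l2norm (0\<^sub>v n @\<^sub>v v) = l2norm v"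
  by (rule l2norm_eqI) (simp add: scalar_prod_append[of _ n _ "dim_vec v"])

lemma l2norm_orthogonal:
  assumes "orthogonal_matrix d Q" "v \<in> carrier_vec d"
  shows "l2norm (Q *\<^sub>v v) = l2norm v"
proof (rule l2norm_eqI)
  have Q: "Q \<in> carrier_mat d d" "Q\<^sup>T * Q = 1\<^sub>m d"
    using assms(1) by (auto simp: orthogonal_matrix_def)
  have "(Q *\<^sub>v v) \<bullet> (Q *\<^sub>v v) = v \<bullet> (Q\<^sup>T *\<^sub>v (Q *\<^sub>v v))"
    using Q assms(2) transpose_vec_mult_scalar[of "Q\<^sup>T" d d "Q *\<^sub>v v" v]
    by simp
  also have "Q\<^sup>T *\<^sub>v (Q *\<^sub>v v) = v"
    using Q assms(2) assoc_mult_mat_vec[of "Q\<^sup>T" d d Q d v] by simp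
  finally show "(Q *\<^sub>v v) \<bullet> (Q *\<^sub>v v) = v \<bullet> v" .
qed

lemma orthogonal_matrix_transpose: "orthogonal_matrix d Q \<Longrightarrow> orthogonal_matrix d Q\<^sup>T"
  by (auto simp: orthogonal_matrix_def)

section \<open>Operator norm\<close>

text \<open>Cauchy-Schwarz in each row gives a crude finite constant. It makes the set in the
  supremum \<open>op_norm\<close> bounded above, and it settles vectors of norm 0, which cannot be
  normalized.\<close>

lemma l2norm_mult_le_sum:
  assumes "v \<in> carrier_vec (dim_col M)"
  shows "l2norm (M *\<^sub>v v) \<le> (\<Sum>i<dim_row M. l2norm (row M i)) * l2norm v"
proof -
  have "l2norm (M *\<^sub>v v) \<le> (\<Sum>i<dim_row M. \<bar>row M i \<bullet> v\<bar>)"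
    using L2_set_le_sum_abs[of "\<lambda>i. (M *\<^sub>v v) $ i" "{..<dim_row M}"] by (simp add: l2norm_def)
  also have "\<dots> \<le> (\<Sum>i<dim_row M. l2norm (row M i) * l2norm v)"
    using assms by (intro sum_mono scalar_prod_le_l2norm) auto
  finally show ?thesis by (simp add: sum_distrib_right)
qed

lemma op_norm_upper:
  assumes "v \<in> carrier_vec (dim_col M)" "l2norm v \<le> 1"
  shows "l2norm (M *\<^sub>v v) \<le> op_norm M"
  unfolding op_norm_def
proof (rule cSUP_upper)
  let ?c = "\<Sum>i<dim_row M. l2norm (row M i)"
  show "bdd_above ((\<lambda>v. l2norm (M *\<^sub>v v)) ` {v \<in> carrier_vec (dim_col M). l2norm v \<le> 1})"
  proof (rule bdd_aboveI2)
    fix v :: "real vec" assume v: "v \<in> {v \<in> carrier_vec (dim_col M). l2norm v \<le> 1}"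
    then have "?c * l2norm v \<le> ?c * 1"
      by (intro mult_left_mono) (auto intro: sum_nonneg)
    with v l2norm_mult_le_sum[of v M] show "l2norm (M *\<^sub>v v) \<le> ?c" by simp
  qed
qed (use assms in auto)

lemma op_norm_nonneg [simp]: "0 \<le> op_norm M"
  by (rule order_trans[OF l2norm_nonneg op_norm_upper[of "0\<^sub>v (dim_col M)"]]) simp_all

lemma l2norm_mult_le_op_norm:
  assumes v: "v \<in> carrier_vec (dim_col M)"
  shows "l2norm (M *\<^sub>v v) \<le> op_norm M * l2norm v"
proof (cases "l2norm v = 0")
  case True
  with l2norm_mult_le_sum[OF v] show ?thesis by simp
next
  case False
  then have pos: "l2norm v > 0" using l2norm_nonneg[of v] by linarith
  let ?w = "(1 / l2norm v) \<cdot>\<^sub>v v"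
  have "l2norm (M *\<^sub>v ?w) \<le> op_norm M"
    using v pos by (intro op_norm_upper) (auto simp: l2norm_smult)
  moreover have "M *\<^sub>v ?w = (1 / l2norm v) \<cdot>\<^sub>v (M *\<^sub>v v)"
    using v by (intro mult_mat_vec[of M "dim_row M" "dim_col M"]) auto
  ultimately show ?thesis
    using pos by (simp add: l2norm_smult field_simps)
qed

text \<open>From |M^T v|^2 = v . M (M^T v) one factor |M^T v| cancels, unless it is 0. This turns
  bounds proved for transposed matrices into bounds for the original ones.\<close>

lemma op_norm_transpose_le: "op_norm M\<^sup>T \<le> op_norm M"
  unfolding op_norm_def[of "M\<^sup>T"]
proof (rule cSUP_least)
  show "{v :: real vec. v \<in> carrier_vec (dim_col M\<^sup>T) \<and> l2norm v \<le> 1} \<noteq> {}"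
    by (auto intro!: exI[of _ "0\<^sub>v (dim_row M)"])
next
  fix v :: "real vec" assume "v \<in> {v \<in> carrier_vec (dim_col M\<^sup>T). l2norm v \<le> 1}"
  then have v: "v \<in> carrier_vec (dim_row M)" "l2norm v \<le> 1" by auto
  let ?u = "M\<^sup>T *\<^sub>v v"
  have u: "?u \<in> carrier_vec (dim_col M)" by (rule carrier_vecI) simp
  have "(l2norm ?u)\<^sup>2 = v \<bullet> (M *\<^sub>v ?u)"
    using transpose_vec_mult_scalar[of M "dim_row M" "dim_col M" ?u v] u v
    by (simp add: scalar_prod_self[symmetric])
  also have "\<dots> \<le> l2norm v * l2norm (M *\<^sub>v ?u)"
    using scalar_prod_le_l2norm[of v "dim_row M" "M *\<^sub>v ?u"] v carrier_vecI[of "M *\<^sub>v ?u"]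
    by simp
  also have "\<dots> \<le> 1 * (op_norm M * l2norm ?u)"
    using v l2norm_mult_le_op_norm[OF u] by (intro mult_mono) auto
  finally have *: "l2norm ?u * l2norm ?u \<le> op_norm M * l2norm ?u"
    by (simp add: power2_eq_square)
  show "l2norm ?u \<le> op_norm M"
  proof (cases "l2norm ?u = 0")
    case False
    then have "l2norm ?u > 0" using l2norm_nonneg[of ?u] by linarith
    with * show ?thesis by simp
  qed simp
qed

section \<open>Singular values\<close>

text \<open>If X^T X v = a v, then a |v|^2 = |X v|^2, so a \<ge> 0. This matters because
  \<open>sqrt\<close> takes negative values at negative arguments. The shift by \<open>Suc\<close>
  matches the numbering of matrix entries from 0.\<close>

lemma sigma_nonneg_decreasing:
  shows sigma_nonneg: "0 \<le> sigma X i"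
    and sigma_antimono: "antimono (\<lambda>i. sigma X (Suc i))"
proof -
  let ?G = "X\<^sup>T * X"
  let ?xs = "singular_values X"
  have G: "?G \<in> carrier_mat (dim_col X) (dim_col X)" by (rule carrier_matI) simp_all
  have "char_poly ?G \<noteq> 0" using degree_monic_char_poly[OF G] by auto
  have root_nonneg: "0 \<le> a" if "poly (char_poly ?G) a = 0" for a
  proof -
    have "eigenvalue ?G a" using that eigenvalue_root_char_poly[OF G] by simp
    then obtain v where v: "v \<in> carrier_vec (dim_col X)" "v \<noteq> 0\<^sub>v (dim_col X)"
      and eq: "?G *\<^sub>v v = a \<cdot>\<^sub>v v"
      by (auto simp: eigenvalue_def eigenvector_def)
    have Xv: "X *\<^sub>v v \<in> carrier_vec (dim_row X)" by (rule carrier_vecI) simp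
    have "a \<cdot>\<^sub>v v = X\<^sup>T *\<^sub>v (X *\<^sub>v v)"
      unfolding eq[symmetric] by (rule assoc_mult_mat_vec) (use v in auto)
    moreover have "(a \<cdot>\<^sub>v v) \<bullet> v = a * (l2norm v)\<^sup>2"
      unfolding scalar_prod_self[symmetric] by (rule smult_scalar_prod_distrib) (use v in auto)
    ultimately have "a * (l2norm v)\<^sup>2 = (X\<^sup>T *\<^sub>v (X *\<^sub>v v)) \<bullet> v" by simp
    also have "\<dots> = (l2norm (X *\<^sub>v v))\<^sup>2"
      unfolding scalar_prod_self[symmetric]
      by (rule transpose_vec_mult_scalar[OF _ v(1) Xv]) simp
    finally have "0 \<le> a * (l2norm v)\<^sup>2" by simp
    moreover have "0 < (l2norm v)\<^sup>2" using v by (simp add: l2norm_eq_0_iff)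
    ultimately show ?thesis by (simp add: zero_le_mult_iff)
  qed
  have nonneg: "0 \<le> x" if "x \<in> set ?xs" for x
    using that root_nonneg \<open>char_poly ?G \<noteq> 0\<close> by (auto simp: singular_values_def)
  have "sorted (rev ?xs)" by (simp add: singular_values_def)
  then have anti: "?xs ! j \<le> ?xs ! i" if "i \<le> j" "j < length ?xs" for i j
    using that by (simp add: sorted_rev_nth_mono)
  show "0 \<le> sigma X i"
    by (auto simp: sigma_def intro!: nonneg nth_mem)
  \<comment> \<open>Past the end of the list \<open>sigma\<close> is 0, so monotonicity across the
    end rests on the entries being nonnegative.\<close>
  show "antimono (\<lambda>i. sigma X (Suc i))"
    by (rule antimonoI) (auto simp: sigma_def intro!: anti nonneg nth_mem)
qed

section \<open>Rectangular diagonal matrices\<close>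

text \<open>With \<open>s\<close> defined on all indices, transposing only exchanges
  \<open>p\<close> and \<open>q\<close>.\<close>

definition rect_diag :: "nat \<Rightarrow> nat \<Rightarrow> (nat \<Rightarrow> real) \<Rightarrow> real mat" where
  "rect_diag p q s = mat p q (\<lambda>(i, j). if i = j then s i else 0)"

lemma rect_diag_transpose: "(rect_diag p q s)\<^sup>T = rect_diag q p s"
  by (rule eq_matI) (auto simp: rect_diag_def)

lemma l2norm_rect_diag_power2:
  assumes w: "w \<in> carrier_vec q"
  shows "(l2norm (rect_diag p q s *\<^sub>v w))\<^sup>2 = (\<Sum>l<min p q. (s l)\<^sup>2 * (w $ l)\<^sup>2)"
proof -
  have entry: "(rect_diag p q s *\<^sub>v w) $ l = (if l < q then s l * w $ l else 0)" if "l < p" for l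
  proof -
    have "(rect_diag p q s *\<^sub>v w) $ l = (\<Sum>i<q. if l = i then s l * w $ i else 0)"
      using that w
      by (auto simp: rect_diag_def scalar_prod_def atLeast0LessThan if_distrib[of "\<lambda>x. x * _"]
          cong: if_cong)
    then show ?thesis by simp
  qed
  have "(l2norm (rect_diag p q s *\<^sub>v w))\<^sup>2 = (\<Sum>l<p. if l < q then (s l)\<^sup>2 * (w $ l)\<^sup>2 else 0)"
    using entry by (auto simp: l2norm_power2 rect_diag_def power_mult_distrib intro!: sum.cong)
  also have "\<dots> = (\<Sum>l<min p q. (s l)\<^sup>2 * (w $ l)\<^sup>2)"
    by (rule sum.mono_neutral_cong_right) auto
  finally show ?thesis .
qed

text \<open>Only the weights \<open>s l\<close> with \<open>l \<ge> j\<close> act on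
  \<open>w\<close>, and \<open>s j\<close> is the largest of them. Together with
  \<open>l2norm_rect_diag_ge\<close> this is the Courant-Fischer argument in coordinates.\<close>

lemma l2norm_rect_diag_le:
  assumes w: "w \<in> carrier_vec q" "\<And>l. l < j \<Longrightarrow> w $ l = 0"
    and s: "antimono s" "\<And>l. 0 \<le> s l"
  shows "l2norm (rect_diag p q s *\<^sub>v w) \<le> s j * l2norm w"
proof (rule power2_le_imp_le)
  have "(\<Sum>l<min p q. (s l)\<^sup>2 * (w $ l)\<^sup>2) \<le> (\<Sum>l<q. (s j)\<^sup>2 * (w $ l)\<^sup>2)"
  proof (rule sum_le_included[where i = id])
    show "\<forall>x\<in>{..<min p q}. \<exists>y\<in>{..<q}. id y = x \<and> (s x)\<^sup>2 * (w $ x)\<^sup>2 \<le> (s j)\<^sup>2 * (w $ y)\<^sup>2"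
    proof
      fix l assume l: "l \<in> {..<min p q}"
      have "(s l)\<^sup>2 * (w $ l)\<^sup>2 \<le> (s j)\<^sup>2 * (w $ l)\<^sup>2"
        using w(2)[of l] antimonoD[OF s(1), of j l] s(2)[of l]
        by (cases "l < j") (auto intro!: mult_right_mono power_mono)
      with l show "\<exists>y\<in>{..<q}. id y = l \<and> (s l)\<^sup>2 * (w $ l)\<^sup>2 \<le> (s j)\<^sup>2 * (w $ y)\<^sup>2" by auto
    qed
  qed auto
  then show "(l2norm (rect_diag p q s *\<^sub>v w))\<^sup>2 \<le> (s j * l2norm w)\<^sup>2"
    using w(1) unfolding l2norm_rect_diag_power2[OF w(1)]
    by (simp add: power_mult_distrib l2norm_power2 sum_distrib_left)
qed (use s in simp)

lemma l2norm_rect_diag_ge: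
  assumes w: "w \<in> carrier_vec q" "\<And>l. j < l \<Longrightarrow> l < q \<Longrightarrow> w $ l = 0"
    and s: "antimono s" "\<And>l. 0 \<le> s l" and j: "j < p" "j < q"
  shows "s j * l2norm w \<le> l2norm (rect_diag p q s *\<^sub>v w)"
proof (rule power2_le_imp_le)
  \<comment> \<open>As \<open>j < p\<close>, the coordinates from \<open>min p q\<close> on lie
    beyond \<open>j\<close>, where \<open>w\<close> is zero, so the diagonal matrix cuts off no part
    of \<open>w\<close>.\<close>
  have "(\<Sum>l<q. (s j)\<^sup>2 * (w $ l)\<^sup>2) = (\<Sum>l<min p q. (s j)\<^sup>2 * (w $ l)\<^sup>2)"
    using w(2) j by (intro sum.mono_neutral_right) auto
  also have "\<dots> \<le> (\<Sum>l<min p q. (s l)\<^sup>2 * (w $ l)\<^sup>2)"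
  proof (rule sum_mono)
    fix l assume "l \<in> {..<min p q}"
    then show "(s j)\<^sup>2 * (w $ l)\<^sup>2 \<le> (s l)\<^sup>2 * (w $ l)\<^sup>2"
      using w(2)[of l] antimonoD[OF s(1), of l j] s(2)[of j]
      by (cases "j < l") (auto intro!: mult_right_mono power_mono)
  qed
  finally show "(s j * l2norm w)\<^sup>2 \<le> (l2norm (rect_diag p q s *\<^sub>v w))\<^sup>2"
    using w(1) unfolding l2norm_rect_diag_power2[OF w(1)]
    by (simp add: power_mult_distrib l2norm_power2 sum_distrib_left)
qed simp

section \<open>Dimension counting by a determinant\<close>

text \<open>The square matrix with rows \<open>f l\<close>, row \<open>j\<close> replaced by zero,
  has determinant 0 and hence a nonzero kernel vector. It supplies the common vector of two
  subspaces, each given by linear equations.\<close>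

lemma exists_common_orthogonal:
  fixes f :: "nat \<Rightarrow> 'a :: idom vec"
  assumes "j < q" and f: "\<And>l. l < q \<Longrightarrow> f l \<in> carrier_vec q"
  obtains w where "w \<in> carrier_vec q" "w \<noteq> 0\<^sub>v q"
    "\<And>l. l < q \<Longrightarrow> l \<noteq> j \<Longrightarrow> f l \<bullet> w = 0"
proof -
  let ?g = "\<lambda>l. if l = j then 0\<^sub>v q else f l"
  let ?M = "mat\<^sub>r q q ?g"
  have M: "?M \<in> carrier_mat q q" by simp
  have "det (mat\<^sub>r q q (\<lambda>l. if l = j then 0\<^sub>v q else (if l < q then f l else 0\<^sub>v q))) = 0"
    using f by (intro det_row_0[OF \<open>j < q\<close>]) auto
  also have "mat\<^sub>r q q (\<lambda>l. if l = j then 0\<^sub>v q else (if l < q then f l else 0\<^sub>v q)) = ?M"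
    by (rule eq_matI) auto
  finally obtain w where w: "w \<in> carrier_vec q" "w \<noteq> 0\<^sub>v q" "?M *\<^sub>v w = 0\<^sub>v q"
    using det_0_iff_vec_prod_zero[OF M] by auto
  have "f l \<bullet> w = 0" if "l < q" "l \<noteq> j" for l
  proof -
    have "(?M *\<^sub>v w) $ l = row ?M l \<bullet> w" using that by simp
    also have "row ?M l = f l" using that f by (subst row_mat_of_row_fun) auto
    finally show ?thesis using w(3) that by simp
  qed
  with w show thesis using that by blast
qed


section \<open>Singular value decompositions in coordinates\<close>

text \<open>An arbitrary decreasing \<open>s\<close> replaces \<open>sigma X\<close>, so that the
  notion passes to the transpose without a comparison of the characteristic polynomials of X^T X and
  X X^T.\<close>

definition has_svd :: "nat \<Rightarrow> nat \<Rightarrow> real mat \<Rightarrow> real mat \<Rightarrow> real mat \<Rightarrow> (nat \<Rightarrow> real) \<Rightarrow> bool" where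
  "has_svd p q X U V s \<longleftrightarrow> X \<in> carrier_mat p q \<and> orthogonal_matrix p U \<and> orthogonal_matrix q V \<and>
     U * X * V = rect_diag p q s \<and> antimono s \<and> (\<forall>l. 0 \<le> s l)"

lemma has_svd_transpose:
  assumes "has_svd p q X U V s"
  shows "has_svd q p X\<^sup>T V\<^sup>T U\<^sup>T s"
proof -
  have c: "X \<in> carrier_mat p q" "U \<in> carrier_mat p p" "V \<in> carrier_mat q q"
    using assms by (auto simp: has_svd_def orthogonal_matrix_def)
  have "V\<^sup>T * X\<^sup>T * U\<^sup>T = V\<^sup>T * (U * X)\<^sup>T"
    using c by (simp add: transpose_mult[of U p p X q] assoc_mult_mat[of "V\<^sup>T" q q "X\<^sup>T" p "U\<^sup>T" p])
  also have "\<dots> = (U * X * V)\<^sup>T"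
    using c by (intro transpose_mult[symmetric]) auto
  finally show ?thesis
    using assms by (simp add: has_svd_def orthogonal_matrix_transpose rect_diag_transpose)
qed

lemma is_svd_imp_has_svd:
  assumes "is_svd X Q Q'" "X \<in> carrier_mat p q"
  shows "has_svd p q X Q Q' (\<lambda>i. sigma X (Suc i))"
  using assms by (auto simp: has_svd_def is_svd_def Sigma_mat_def rect_diag_def sigma_nonneg
      intro: sigma_antimono)

text \<open>\<open>U\<close> preserves norms and \<open>U * X * V\<close> is diagonal. Here
  \<open>w\<close> holds coordinates along the columns of \<open>V\<close>, the right singular
  vectors of \<open>X\<close>.\<close>

lemma l2norm_svd:
  assumes svd: "has_svd p q X U V s" and w: "w \<in> carrier_vec q"
  shows "l2norm (X *\<^sub>v (V *\<^sub>v w)) = l2norm (rect_diag p q s *\<^sub>v w)"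
proof -
  have c: "X \<in> carrier_mat p q" "U \<in> carrier_mat p p" "V \<in> carrier_mat q q"
    and U: "orthogonal_matrix p U"
    using svd by (auto simp: has_svd_def orthogonal_matrix_def)
  have Vw: "V *\<^sub>v w \<in> carrier_vec q" by (rule mult_mat_vec_carrier[OF c(3) w])
  have "rect_diag p q s *\<^sub>v w = (U * X) *\<^sub>v (V *\<^sub>v w)"
    using svd assoc_mult_mat_vec[OF mult_carrier_mat[OF c(2,1)] c(3) w] by (simp add: has_svd_def)
  also have "\<dots> = U *\<^sub>v (X *\<^sub>v (V *\<^sub>v w))"
    by (rule assoc_mult_mat_vec[OF c(2,1) Vw])
  finally show ?thesis
    using l2norm_orthogonal[OF U mult_mat_vec_carrier[OF c(1) Vw]] by simp
qed

text \<open>The first \<open>j\<close> columns of \<open>V\<close> meet zero coordinates of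
  \<open>w\<close>, and \<open>vec_last\<close> drops the first \<open>k\<close> rows. This is the
  origin of the blocks in \<open>mu\<close>.\<close>

lemma vec_last_mult_block:
  assumes V: "V \<in> carrier_mat q q" and w: "w \<in> carrier_vec q" "\<And>l. l < j \<Longrightarrow> w $ l = 0"
    and "k \<le> q" "j \<le> q"
  shows "vec_last (V *\<^sub>v w) (q - k) = block V (k + 1) q (j + 1) q *\<^sub>v vec_last w (q - j)"
proof -
  define B where "B = block V (k + 1) q (j + 1) q"
  have blk: "B = mat (q - k) (q - j) (\<lambda>(a, b). V $$ (k + a, j + b))"
    unfolding B_def using V by (subst block_eq) auto
  have "vec_last (V *\<^sub>v w) (q - k) = B *\<^sub>v vec_last w (q - j)"
  proof (rule eq_vecI)
    show "dim_vec (vec_last (V *\<^sub>v w) (q - k)) = dim_vec (B *\<^sub>v vec_last w (q - j))"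
      by (simp add: blk)
    fix i assume "i < dim_vec (B *\<^sub>v vec_last w (q - j))"
    then have i: "i < q - k" by (simp add: blk)
    have "vec_last (V *\<^sub>v w) (q - k) $ i = (\<Sum>l\<in>{0..<q}. V $$ (k + i, l) * w $ l)"
      using i V w(1) \<open>k \<le> q\<close> by (simp add: vec_last_def scalar_prod_def)
    also have "\<dots> = (\<Sum>l\<in>{j..<q}. V $$ (k + i, l) * w $ l)"
      using w(2) \<open>j \<le> q\<close> by (intro sum.mono_neutral_right) auto
    also have "\<dots> = (\<Sum>l\<in>{0..<q - j}. V $$ (k + i, j + l) * w $ (j + l))"
      by (rule sum.reindex_bij_witness[of _ "\<lambda>l. j + l" "\<lambda>l. l - j"]) auto
    also have "\<dots> = (B *\<^sub>v vec_last w (q - j)) $ i"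
      using i w(1) \<open>j \<le> q\<close> by (simp add: blk vec_last_def scalar_prod_def)
    finally show "vec_last (V *\<^sub>v w) (q - k) $ i = (B *\<^sub>v vec_last w (q - j)) $ i" .
  qed
  then show ?thesis unfolding B_def .
qed

lemma l2norm_vec_last_le:
  assumes "w \<in> carrier_vec q"
  shows "l2norm (vec_last w (q - j)) \<le> l2norm w"
proof (rule power2_le_imp_le)
  \<comment> \<open>\<open>vec_last\<close> starts at index \<open>q - (q - j)\<close>, which is
    \<open>min j q\<close> and so is also right for \<open>j > q\<close>.\<close>
  have "(\<Sum>i<q - j. (w $ (q - (q - j) + i))\<^sup>2) = (\<Sum>l\<in>{q - (q - j)..<q}. (w $ l)\<^sup>2)"
    by (rule sum.reindex_bij_witness[of _ "\<lambda>l. l - (q - (q - j))" "\<lambda>l. q - (q - j) + l"]) auto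
  also have "\<dots> \<le> (\<Sum>l<q. (w $ l)\<^sup>2)"
    by (rule sum_mono2) auto
  finally show "(l2norm (vec_last w (q - j)))\<^sup>2 \<le> (l2norm w)\<^sup>2"
    using assms by (simp add: l2norm_power2 vec_last_def add.commute)
qed simp

section \<open>One-sided perturbation bound\<close>

text \<open>The two matrices are tied to \<open>D\<close> only through \<open>close\<close>, so the
  bound serves for both orders of the pair and for the transposes.\<close>

lemma singular_value_le_add_block:
  assumes X: "has_svd p q X U V s" and Y: "has_svd p q Y P W t"
    and D: "D \<in> carrier_mat (p - k) (q - k)" and k: "k \<le> q" and j: "j < p" "j < q"
    and close: "\<And>v. v \<in> carrier_vec q \<Longrightarrow>
      l2norm (Y *\<^sub>v v) \<le> l2norm (X *\<^sub>v v) + l2norm (D *\<^sub>v vec_last v (q - k))"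
  shows "t j \<le> s j + op_norm (D * block V (k + 1) q (j + 1) q)"
proof -
  have V: "V \<in> carrier_mat q q" and W: "W \<in> carrier_mat q q" "W * W\<^sup>T = 1\<^sub>m q"
    and oV: "orthogonal_matrix q V" and oW: "orthogonal_matrix q W\<^sup>T"
    and s: "antimono s" "\<And>l. 0 \<le> s l" and t: "antimono t" "\<And>l. 0 \<le> t l"
    using X Y by (auto simp: has_svd_def orthogonal_matrix_def)
  \<comment> \<open>Coordinate \<open>l < j\<close> of \<open>w\<close> and coordinate \<open>l > j\<close> of \<open>W\<^sup>T V w\<close> must vanish: only \<open>q - 1\<close> conditions,
    as nothing is asked for \<open>l = j\<close>.\<close>
  define f where "f l = (if l < j then unit_vec q l else row (W\<^sup>T * V) l)" for l
  obtain w where w: "w \<in> carrier_vec q" "w \<noteq> 0\<^sub>v q"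
    and fw: "\<And>l. l < q \<Longrightarrow> l \<noteq> j \<Longrightarrow> f l \<bullet> w = 0"
    by (rule exists_common_orthogonal[of j q f]) (use j V in \<open>auto simp: f_def row_def\<close>)
  define v where "v = V *\<^sub>v w"
  define u where "u = W\<^sup>T *\<^sub>v v"
  let ?B = "block V (k + 1) q (j + 1) q"
  let ?c = "op_norm (D * ?B)"
  let ?w = "vec_last w (q - j)"
  have v: "v \<in> carrier_vec q" unfolding v_def by (rule mult_mat_vec_carrier[OF V w(1)])
  have u: "u \<in> carrier_vec q" unfolding u_def using W(1) v by auto
  have u_eq: "u = (W\<^sup>T * V) *\<^sub>v w"
    unfolding u_def v_def by (rule assoc_mult_mat_vec[symmetric]) (use W V w in auto)
  have Wu: "W *\<^sub>v u = v"
    unfolding u_def using W v assoc_mult_mat_vec[of W q q "W\<^sup>T" q v] by simp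
  have w0: "w $ l = 0" if "l < j" for l
    using fw[of l] that j w(1) by (simp add: f_def)
  have u0: "u $ l = 0" if "j < l" "l < q" for l
    using fw[of l] that W(1) V unfolding u_eq by (simp add: f_def)
  have norms: "l2norm u = l2norm w"
    unfolding u_def v_def using l2norm_orthogonal[OF oW] l2norm_orthogonal[OF oV w(1)] v
    by (simp add: v_def)
  have pos: "0 < l2norm w"
    using w l2norm_eq_0_iff[OF w(1)] l2norm_nonneg[of w] by linarith
  have B: "?B \<in> carrier_mat (q - k) (q - j)"
    using V by (subst block_eq) auto
  have wl: "?w \<in> carrier_vec (q - j)" by simp
  have "D *\<^sub>v vec_last v (q - k) = D *\<^sub>v (?B *\<^sub>v ?w)"
    unfolding v_def using vec_last_mult_block[OF V w(1) w0 k] j by simp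
  also have "\<dots> = (D * ?B) *\<^sub>v ?w"
    by (rule assoc_mult_mat_vec[OF D B wl, symmetric])
  finally have "l2norm (D *\<^sub>v vec_last v (q - k)) \<le> ?c * l2norm ?w"
    using l2norm_mult_le_op_norm[of ?w "D * ?B"] B by simp
  also have "\<dots> \<le> ?c * l2norm w"
    by (intro mult_left_mono l2norm_vec_last_le w(1)) simp
  finally have Dv: "l2norm (D *\<^sub>v vec_last v (q - k)) \<le> ?c * l2norm w" .
  \<comment> \<open>The common vector \<open>v\<close> has coordinates \<open>u\<close> up to index
    \<open>j\<close> for \<open>Y\<close> and \<open>w\<close> from index \<open>j\<close> on for
    \<open>X\<close>. Hence the lower bound for \<open>Y\<close> and the upper bound for
    \<open>X\<close> meet at \<open>j\<close>, with equal norms of \<open>u\<close> and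
    \<open>w\<close>.\<close>
  have "t j * l2norm w \<le> l2norm (rect_diag p q t *\<^sub>v u)"
    using l2norm_rect_diag_ge[OF u u0 t j] norms by simp
  also have "\<dots> = l2norm (Y *\<^sub>v v)"
    using l2norm_svd[OF Y u] Wu by simp
  also have "\<dots> \<le> l2norm (X *\<^sub>v v) + l2norm (D *\<^sub>v vec_last v (q - k))"
    by (rule close[OF v])
  also have "\<dots> \<le> s j * l2norm w + ?c * l2norm w"
    using l2norm_svd[OF X w(1)] l2norm_rect_diag_le[OF w(1) w0 s, where p = p] Dv
    by (intro add_mono) (auto simp: v_def)
  finally have "t j * l2norm w \<le> (s j + ?c) * l2norm w" by (simp add: algebra_simps)
  with pos show ?thesis by simp
qed

lemma block_transpose:
  assumes "1 \<le> a" "b \<le> dim_row M" "1 \<le> c" "d \<le> dim_col M"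
  shows "block M\<^sup>T c d a b = (block M a b c d)\<^sup>T"
  using assms by (subst (1 2) block_eq) (auto intro!: eq_matI)

text \<open>\<open>mu\<close> is a minimum, so two bounds are due. The one with the block of
  \<open>Q\<close> comes from the transposed matrices, for which the transpose of \<open>Q\<close>
  is the right factor.\<close>

lemma sigma_le_add_mu:
  assumes X: "X \<in> carrier_mat m n" "is_svd X Q Q'" and Y: "Y \<in> carrier_mat m n" "is_svd Y P P'"
    and D: "D \<in> carrier_mat (m - k) (n - k)" and k: "k \<le> m" "k \<le> n" and j: "j < m" "j < n"
    and close: "\<And>v. v \<in> carrier_vec n \<Longrightarrow>
      l2norm (Y *\<^sub>v v) \<le> l2norm (X *\<^sub>v v) + l2norm (D *\<^sub>v vec_last v (n - k))"
    and closeT: "\<And>v. v \<in> carrier_vec m \<Longrightarrow>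
      l2norm (Y\<^sup>T *\<^sub>v v) \<le> l2norm (X\<^sup>T *\<^sub>v v) + l2norm (D\<^sup>T *\<^sub>v vec_last v (m - k))"
  shows "sigma Y (Suc j) \<le> sigma X (Suc j) + mu D Q Q' j k"
proof -
  note svds = is_svd_imp_has_svd[OF X(2,1)] is_svd_imp_has_svd[OF Y(2,1)]
  have Q: "Q \<in> carrier_mat m m" and Q': "Q' \<in> carrier_mat n n"
    using svds(1) by (auto simp: has_svd_def orthogonal_matrix_def)
  let ?B = "block Q (j + 1) m (k + 1) m"
  have B: "?B \<in> carrier_mat (m - j) (m - k)"
    using Q by (subst block_eq) auto
  have "D\<^sup>T * block Q\<^sup>T (k + 1) m (j + 1) m = D\<^sup>T * ?B\<^sup>T"
    using Q by (subst block_transpose) auto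
  also have "\<dots> = (?B * D)\<^sup>T"
    by (rule transpose_mult[OF B D, symmetric])
  finally have "sigma Y (Suc j) \<le> sigma X (Suc j) + op_norm (?B * D)\<^sup>T"
    using singular_value_le_add_block[OF svds[THEN has_svd_transpose] _ k(1) j(2,1) closeT] D by simp
  then have "sigma Y (Suc j) \<le> sigma X (Suc j) + op_norm (?B * D)"
    using op_norm_transpose_le[of "?B * D"] by linarith
  moreover have "sigma Y (Suc j) \<le> sigma X (Suc j) + op_norm (D * block Q' (k + 1) n (j + 1) n)"
    by (rule singular_value_le_add_block[OF svds D k(2) j close])
  ultimately show ?thesis
    using Q Q' by (simp add: mu_def min_def)
qed

section \<open>Deleting the corner block\<close>

lemma four_block_mult_vec_corner:
  fixes A B C D :: "'a :: semiring_0 mat"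
  assumes M: "A \<in> carrier_mat k k" "B \<in> carrier_mat k (q - k)" "C \<in> carrier_mat (p - k) k"
      "D \<in> carrier_mat (p - k) (q - k)"
    and k: "k \<le> q" and v: "v \<in> carrier_vec q"
  shows "four_block_mat A B C D *\<^sub>v v =
    four_block_mat A B C (0\<^sub>m (p - k) (q - k)) *\<^sub>v v + (0\<^sub>v k @\<^sub>v (D *\<^sub>v vec_last v (q - k)))"
proof -
  let ?a = "vec_first v k" and ?b = "vec_last v (q - k)" and ?Z = "0\<^sub>m (p - k) (q - k) :: 'a mat"
  have split: "v = ?a @\<^sub>v ?b"
    using vec_first_last_append[of v k "q - k"] k v by simp
  have Z: "?Z \<in> carrier_mat (p - k) (q - k)" by simp
  note vs = vec_first_carrier[of v k] vec_last_carrier[of v "q - k"]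
  have c: "A *\<^sub>v ?a + B *\<^sub>v ?b \<in> carrier_vec k" "C *\<^sub>v ?a \<in> carrier_vec (p - k)"
    "D *\<^sub>v ?b \<in> carrier_vec (p - k)" "?Z *\<^sub>v ?b = 0\<^sub>v (p - k)"
    using M vs by auto
  have "four_block_mat A B C D *\<^sub>v v = (A *\<^sub>v ?a + B *\<^sub>v ?b) @\<^sub>v (C *\<^sub>v ?a + D *\<^sub>v ?b)"
    by (subst split) (rule four_block_mat_mult_vec[OF M vs])
  moreover have "four_block_mat A B C ?Z *\<^sub>v v = (A *\<^sub>v ?a + B *\<^sub>v ?b) @\<^sub>v (C *\<^sub>v ?a + ?Z *\<^sub>v ?b)"
    by (subst split) (rule four_block_mat_mult_vec[OF M(1-3) Z vs])
  moreover have "((A *\<^sub>v ?a + B *\<^sub>v ?b) @\<^sub>v (C *\<^sub>v ?a + ?Z *\<^sub>v ?b)) + (0\<^sub>v k @\<^sub>v (D *\<^sub>v ?b)) =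
    (A *\<^sub>v ?a + B *\<^sub>v ?b) @\<^sub>v (C *\<^sub>v ?a + D *\<^sub>v ?b)"
    using c M by (intro eq_vecI) (auto simp: index_append_vec)
  ultimately show ?thesis by simp
qed

lemma l2norm_four_block_corner:
  assumes M: "A \<in> carrier_mat k k" "B \<in> carrier_mat k (q - k)" "C \<in> carrier_mat (p - k) k"
      "D \<in> carrier_mat (p - k) (q - k)"
    and k: "k \<le> p" "k \<le> q" and v: "v \<in> carrier_vec q"
  defines "R \<equiv> four_block_mat A B C D"
    and "R\<^sub>0 \<equiv> four_block_mat A B C (0\<^sub>m (p - k) (q - k))"
  shows "l2norm (R *\<^sub>v v) \<le> l2norm (R\<^sub>0 *\<^sub>v v) + l2norm (D *\<^sub>v vec_last v (q - k))"
    and "l2norm (R\<^sub>0 *\<^sub>v v) \<le> l2norm (R *\<^sub>v v) + l2norm (D *\<^sub>v vec_last v (q - k))"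
proof -
  let ?e = "0\<^sub>v k @\<^sub>v (D *\<^sub>v vec_last v (q - k))"
  have e: "?e \<in> carrier_vec p" "l2norm ?e = l2norm (D *\<^sub>v vec_last v (q - k))"
    using M(4) k(1) by (auto simp: l2norm_append_zero intro!: carrier_vecI)
  have c: "R *\<^sub>v v \<in> carrier_vec p" "R\<^sub>0 *\<^sub>v v \<in> carrier_vec p"
    using M k by (auto simp: R_def R\<^sub>0_def intro!: carrier_vecI)
  have eq: "R *\<^sub>v v = R\<^sub>0 *\<^sub>v v + ?e"
    unfolding R_def R\<^sub>0_def by (rule four_block_mult_vec_corner[OF M k(2) v])
  \<comment> \<open>Subtracting the correction instead of adding it gives the reverse estimate, as
    its norm is the same.\<close>
  then have eq': "R\<^sub>0 *\<^sub>v v = R *\<^sub>v v + - ?e"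
    using c e(1) by (intro eq_vecI) auto
  show "l2norm (R *\<^sub>v v) \<le> l2norm (R\<^sub>0 *\<^sub>v v) + l2norm (D *\<^sub>v vec_last v (q - k))"
    unfolding eq e(2)[symmetric] by (rule l2norm_add_le[OF c(2) e(1)])
  have "l2norm (R *\<^sub>v v + - ?e) \<le> l2norm (R *\<^sub>v v) + l2norm (- ?e)"
    by (rule l2norm_add_le[OF c(1)]) (use e(1) in simp)
  then show "l2norm (R\<^sub>0 *\<^sub>v v) \<le> l2norm (R *\<^sub>v v) + l2norm (D *\<^sub>v vec_last v (q - k))"
    unfolding eq'[symmetric] e(2)[symmetric] by simp
qed

section \<open>Vanishing singular values for a zero corner\<close>

text \<open>A nonzero kernel vector whose coordinates along the right singular vectors vanish beyond
  index \<open>j\<close> forces the singular value at \<open>j\<close> to be 0.\<close>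

lemma sigma_zero_corner:
  assumes M: "A \<in> carrier_mat k k" "B \<in> carrier_mat k (n - k)" "C \<in> carrier_mat (m - k) k"
    and R: "R = four_block_mat A B C (0\<^sub>m (m - k) (n - k))"
    and svd: "is_svd R Q Q'" and j: "2 * k \<le> j" "j < n" "j < m"
  shows "sigma R (Suc j) = 0"
proof -
  have Rc: "R \<in> carrier_mat m n"
    using M j by (auto simp: R intro!: carrier_matI)
  have Rz: "R $$ (i, l) = 0" if "k \<le> i" "i < m" "k \<le> l" "l < n" for i l
    using that M by (simp add: R)
  note svd' = is_svd_imp_has_svd[OF svd Rc]
  have V: "Q' \<in> carrier_mat n n"
    using svd' by (auto simp: has_svd_def orthogonal_matrix_def)
  \<comment> \<open>The first \<open>2 k\<close> conditions make the first \<open>k\<close> entries of \<open>v = Q' w\<close> and of \<open>R v\<close> vanish, hence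
    \<open>R v = 0\<close>. The index \<open>j \<ge> 2 k\<close> carries no condition.\<close>
  define f where "f l = (if l < k then row Q' l else if l < 2 * k then row (R * Q') (l - k)
    else unit_vec n l)" for l
  obtain w where w: "w \<in> carrier_vec n" "w \<noteq> 0\<^sub>v n"
    and fw: "\<And>l. l < n \<Longrightarrow> l \<noteq> j \<Longrightarrow> f l \<bullet> w = 0"
    by (rule exists_common_orthogonal[of j n f]) (use j V in \<open>auto simp: f_def row_def\<close>)
  define v where "v = Q' *\<^sub>v w"
  have v: "v \<in> carrier_vec n" unfolding v_def by (rule mult_mat_vec_carrier[OF V w(1)])
  have w0: "w $ l = 0" if "j < l" "l < n" for l
    using fw[of l] that j w(1) by (simp add: f_def)
  have v0: "v $ l = 0" if "l < k" for l
    using fw[of l] that j V by (simp add: f_def v_def)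
  have Rv: "R *\<^sub>v v = (R * Q') *\<^sub>v w"
    unfolding v_def by (rule assoc_mult_mat_vec[symmetric, OF Rc V w(1)])
  have "(R *\<^sub>v v) $ i = 0" if i: "i < m" for i
  proof (cases "i < k")
    case True
    \<comment> \<open>Row \<open>i\<close> of \<open>R * Q'\<close> sits at index
      \<open>i + k\<close> of \<open>f\<close>, which is below \<open>2 * k\<close> and so differs
      from \<open>j\<close>.\<close>
    then show ?thesis
      using fw[of "i + k"] i j Rc V unfolding Rv by (simp add: f_def)
  next
    case False
    \<comment> \<open>From row \<open>k\<close> on, \<open>R\<close> can be nonzero only in the
      first \<open>k\<close> columns, where \<open>v\<close> vanishes.\<close>
    then have "(\<Sum>l\<in>{0..<n}. R $$ (i, l) * v $ l) = 0"
      using i v0 Rz[of i] by (intro sum.neutral) (metis atLeastLessThan_iff mult_eq_0_iff not_less)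
    then show ?thesis using i Rc v by (simp add: scalar_prod_def)
  qed
  then have "R *\<^sub>v v = 0\<^sub>v m" using Rc by (intro eq_vecI) auto
  then have "sigma R (Suc j) * l2norm w \<le> 0"
    using l2norm_rect_diag_ge[OF w(1) w0 sigma_antimono sigma_nonneg j(3,2), of R]
      l2norm_svd[OF svd' w(1)] by (simp add: v_def)
  moreover have "0 < l2norm w"
    using w l2norm_eq_0_iff[OF w(1)] l2norm_nonneg[of w] by linarith
  ultimately show ?thesis
    using sigma_nonneg[of R "Suc j"] by (simp add: mult_le_0_iff)
qed

section \<open>Passage to the bottom right blocks, and assembly\<close>

text \<open>\<open>c2 Q k\<close> begins at row \<open>k + 1\<close> of \<open>Q\<close>, so its row
  \<open>i - k\<close> lies in row \<open>i\<close> of \<open>Q\<close>, the first row of the block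
  in \<open>mu\<close> for \<open>j = i - 1\<close>. Columns of \<open>Q'\<close> behave
  alike.\<close>

lemma mu_eq_c2:
  assumes Q: "Q \<in> carrier_mat m m" and Q': "Q' \<in> carrier_mat n n" and i: "k < i"
    and k: "k \<le> m" "k \<le> n"
  shows "mu D Q Q' (i - 1) k = min (op_norm (c2_rows Q k i * D)) (op_norm (D * c2_cols Q' k i))"
proof -
  have "c2_rows Q k i = block Q (i - 1 + 1) m (k + 1) m"
    using Q i k by (auto simp: c2_rows_def c2_def block_eq intro!: eq_matI)
  moreover have "c2_cols Q' k i = block Q' (k + 1) n (i - 1 + 1) n"
    using Q' i k by (auto simp: c2_cols_def c2_def block_eq intro!: eq_matI)
  ultimately show ?thesis
    using Q Q' by (simp add: mu_def min.commute)
qed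

theorem theorem1:
  fixes m n k :: nat
    and A B C D R R\<^sub>0 :: "real mat"
    and Q Q' Q\<^sub>0 Q\<^sub>0' :: "real mat"
  assumes "n \<le> m" and "k < n" and "1 \<le> k"
    and "A \<in> carrier_mat k k"
    and "B \<in> carrier_mat k (n - k)"
    and "C \<in> carrier_mat (m - k) k"
    and "D \<in> carrier_mat (m - k) (n - k)"
    and "R = four_block_mat A B C D"
    and "R\<^sub>0 = four_block_mat A B C (0\<^sub>m (m - k) (n - k))"
    and "is_svd R Q Q'"
    and "is_svd R\<^sub>0 Q\<^sub>0 Q\<^sub>0'"
  shows
    "(\<forall>i. 1 \<le> i \<and> i \<le> n \<longrightarrow>
        \<bar>sigma R i - sigma R\<^sub>0 i\<bar> \<le> max (mu D Q Q' (i - 1) k) (mu D Q\<^sub>0 Q\<^sub>0' (i - 1) k)) \<and>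
     (\<forall>i. k < i \<and> i \<le> n \<longrightarrow>
        \<bar>sigma R i - sigma R\<^sub>0 i\<bar> \<le>
          max (min (op_norm (c2_rows Q k i * D)) (op_norm (D * c2_cols Q' k i)))
              (min (op_norm (c2_rows Q\<^sub>0 k i * D)) (op_norm (D * c2_cols Q\<^sub>0' k i)))) \<and>
     (\<forall>i. 2 * k < i \<and> i \<le> n \<longrightarrow>
        sigma R i \<le>
          max (min (op_norm (c2_rows Q k i * D)) (op_norm (D * c2_cols Q' k i)))
              (min (op_norm (c2_rows Q\<^sub>0 k i * D)) (op_norm (D * c2_cols Q\<^sub>0' k i))))"
proof -
  have ABC: "A \<in> carrier_mat k k" "B \<in> carrier_mat k (n - k)" "C \<in> carrier_mat (m - k) k"
    "D \<in> carrier_mat (m - k) (n - k)"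
    and k: "k \<le> m" "k \<le> n" using assms by auto
  have R: "R \<in> carrier_mat m n" and R\<^sub>0: "R\<^sub>0 \<in> carrier_mat m n"
    using carrier_matD[OF ABC(1)] carrier_matD[OF ABC(4)] k assms(8,9)
    by (auto intro!: carrier_matI)
  have T: "A\<^sup>T \<in> carrier_mat k k" "C\<^sup>T \<in> carrier_mat k (m - k)" "B\<^sup>T \<in> carrier_mat (n - k) k"
    "D\<^sup>T \<in> carrier_mat (n - k) (m - k)"
    using ABC by auto
  \<comment> \<open>Transposition exchanges the roles of \<open>B\<close> and \<open>C\<close> and
    keeps the corner shape, so the corner estimates apply again with \<open>m\<close> and
    \<open>n\<close> exchanged.\<close>
  have RT: "R\<^sup>T = four_block_mat A\<^sup>T C\<^sup>T B\<^sup>T D\<^sup>T"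
    "R\<^sub>0\<^sup>T = four_block_mat A\<^sup>T C\<^sup>T B\<^sup>T (0\<^sub>m (n - k) (m - k))"
    unfolding assms(8,9) using transpose_four_block_mat[OF ABC]
      transpose_four_block_mat[OF ABC(1-3), of "0\<^sub>m (m - k) (n - k)"] by auto
  note close = l2norm_four_block_corner[OF ABC k, folded assms(8,9)]
  note closeT = l2norm_four_block_corner[OF T k(2,1), folded RT]
  have part1: "\<bar>sigma R i - sigma R\<^sub>0 i\<bar> \<le> max (mu D Q Q' (i - 1) k) (mu D Q\<^sub>0 Q\<^sub>0' (i - 1) k)"
    if "1 \<le> i" "i \<le> n" for i
  proof -
    have j: "i - 1 < m" "i - 1 < n" and Suc: "Suc (i - 1) = i" using that assms(1) by auto
    \<comment> \<open>Each decomposition bounds the singular value of the other matrix from above;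
      the maximum covers both signs of the difference.\<close>
    have "sigma R\<^sub>0 i \<le> sigma R i + mu D Q Q' (i - 1) k"
      using sigma_le_add_mu[OF R assms(10) R\<^sub>0 assms(11) ABC(4) k j close(2) closeT(2)] Suc by simp
    moreover have "sigma R i \<le> sigma R\<^sub>0 i + mu D Q\<^sub>0 Q\<^sub>0' (i - 1) k"
      using sigma_le_add_mu[OF R\<^sub>0 assms(11) R assms(10) ABC(4) k j close(1) closeT(1)] Suc by simp
    ultimately show ?thesis by linarith
  qed
  have Q: "Q \<in> carrier_mat m m" "Q' \<in> carrier_mat n n" "Q\<^sub>0 \<in> carrier_mat m m" "Q\<^sub>0' \<in> carrier_mat n n"
    using assms(10,11) R R\<^sub>0 by (auto simp: is_svd_def orthogonal_matrix_def)
  have part2: "\<bar>sigma R i - sigma R\<^sub>0 i\<bar> \<le>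
          max (min (op_norm (c2_rows Q k i * D)) (op_norm (D * c2_cols Q' k i)))
              (min (op_norm (c2_rows Q\<^sub>0 k i * D)) (op_norm (D * c2_cols Q\<^sub>0' k i)))"
    if "k < i" "i \<le> n" for i
    using part1[of i] that mu_eq_c2[OF Q(1,2) that(1) k] mu_eq_c2[OF Q(3,4) that(1) k] by simp
  have part3: "sigma R i \<le>
          max (min (op_norm (c2_rows Q k i * D)) (op_norm (D * c2_cols Q' k i)))
              (min (op_norm (c2_rows Q\<^sub>0 k i * D)) (op_norm (D * c2_cols Q\<^sub>0' k i)))"
    if "2 * k < i" "i \<le> n" for i
  proof -
    \<comment> \<open>In the numbering from 0, \<open>2 * k < i\<close> reads
      \<open>2 * k \<le> i - 1\<close>. Once this value is 0, \<open>part2\<close> bounds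
      \<open>sigma R i\<close> itself.\<close>
    have "sigma R\<^sub>0 i = 0"
      using sigma_zero_corner[OF ABC(1-3) assms(9,11), of "i - 1"] that assms(1) by simp
    then show ?thesis using part2[of i] that by linarith
  qed
  show ?thesis using part1 part2 part3 by blast
qed

end
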